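(* Let $\pi\in\Delta(K)$ be an invariant distribution of $M$ (i.e. $\pi M=\pi$). If $v_{n+1}(\pi)=v_n(\pi)$ for some $n\ge 1$, then $v_{n+1+j}(\pi)=v_n(\pi)$ for all $j\in\mathbb N$. In particular, $$i(\pi,M)=\min\{n\in\mathbb N\cup\{+\infty\}: v_{n+1}(\pi)=v_n(\pi)\}.$$
   Context: Setting: $K=\{1,\dots,k\}$ is a finite set, $\Delta(K)$ is the set of probability distributions on $K$ (viewed as $k$-dimensional row vectors; $q(i)$ is the mass of $i$ under $q$), $M$ is a $k\times k$ stochastic matrix, and $u:K\times K\to[0,1]$ is a utility function. For a prior $q\in\Delta(K)$, $\{X_j\}_{j\ge1}$ is the Markov chain on $K$ with $X_1\sim q$ and transition matrix $M$. At each stage $j=1,2,\dots$ a decision maker selects an action $\xi_j\in K$ and then observes only the binary signal $I(\xi_j)=\mathbf 1\{X_j=\xi_j\}$. A policy $\xi=(\xi_j)_{j\ge1}$ specifies each action $\xi_j$ as a (deterministic) function of the past actions $\xi_1,\dots,\xi_{j-1}$ and past signals $I(\xi_1),\dots,I(\xi_{j-1})$ (so $\xi_1$ is a fixed element of $K$). Let $\Xi$ be the set of all policies, and let $P_{q,\xi}$, $E_{q,\xi}$ denote the induced probability and expectation. The value of the $n$-stage problem is $$v_n(q)=\max_{\xi\in\Xi}E_{q,\xi}[u(X_n,\xi_n)].$$ For an invariant distribution $\pi$ the sequence $v_n(\pi)$ is non-decreasing and bounded, and $v_\infty(\pi)=\lim_{n\to\infty}v_n(\pi)$. The predictive learning index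 is $i(\pi,M)=\min\{n\in\mathbb N\cup\{+\infty\}: v_n(\pi)=v_\infty(\pi)\}$, where $\mathbb N=\{1,2,\dots\}$. Convention: the element $n=+\infty$ always belongs to the sets over which the minima are taken (with $v_{+\infty}(\pi)=v_\infty(\pi)$ and $+\infty+1=+\infty$), so a minimum equals $+\infty$ exactly when no finite $n$ satisfies the condition. *)

theory Defs
  imports "HOL-Probability.Probability"
begin

text \<open>
  The finite set \<open>K\<close> is a finite type \<open>'k\<close>, so \<open>K\<close> has an arbitrary positive cardinality.
  Row vectors are of type \<open>real ^ 'k\<close>; for a transition matrix \<open>M\<close>, the entry \<open>M $ i $ j\<close> is the
  probability of moving from \<open>i\<close> to \<open>j\<close>, and \<open>M $ i\<close> is the \<open>i\<close>-th row.
\<close>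

definition distributions :: "(real ^ 'k::finite) set" where
  "distributions = {q. (\<forall>i. 0 \<le> q $ i) \<and> (\<Sum>i\<in>UNIV. q $ i) = 1}"

definition stochastic_matrix :: "real ^ 'k ^ 'k::finite \<Rightarrow> bool" where
  "stochastic_matrix M \<longleftrightarrow> (\<forall>i. M $ i \<in> distributions)"

definition invariant_distribution :: "real ^ 'k ^ 'k::finite \<Rightarrow> real ^ 'k \<Rightarrow> bool" where
  "invariant_distribution M \<pi> \<longleftrightarrow> \<pi> \<in> distributions \<and> \<pi> v* M = \<pi>"

text \<open>\<open>vec_pmf q\<close> is meaningful only for \<open>q \<in> distributions\<close>.\<close>

definition vec_pmf :: "real ^ 'k::finite \<Rightarrow> 'k pmf" where
  "vec_pmf q = embed_pmf (\<lambda>i. q $ i)"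

lemma pmf_vec_pmf:
  assumes "q \<in> distributions"
  shows "pmf (vec_pmf q) i = q $ i"
  unfolding vec_pmf_def
proof (rule pmf_embed_pmf)
  show "0 \<le> q $ x" for x
    using assms by (simp add: distributions_def)
  then have "(\<integral>\<^sup>+x. ennreal (q $ x) \<partial>count_space UNIV) = ennreal (\<Sum>x\<in>UNIV. q $ x)"
    by (simp add: nn_integral_count_space_finite sum_ennreal)
  then show "(\<integral>\<^sup>+x. ennreal (q $ x) \<partial>count_space UNIV) = 1"
    using assms by (simp add: distributions_def)
qed

text \<open>
  Paths of the chain are functions \<open>\<omega> :: nat \<Rightarrow> 'k\<close> indexed from \<open>0\<close>, so that \<open>\<omega> (j - 1)\<close> is the
  state at stage \<open>j \<ge> 1\<close>. The kernel gives the conditional law of \<open>\<omega> n\<close> given \<open>\<omega> 0, \<dots>, \<omega> (n - 1)\<close>.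
\<close>

definition chain_kernel ::
    "real ^ 'k \<Rightarrow> real ^ 'k ^ 'k::finite \<Rightarrow> nat \<Rightarrow> (nat \<Rightarrow> 'k) \<Rightarrow> 'k measure" where
  "chain_kernel q M n \<omega> = measure_pmf (vec_pmf (if n = 0 then q else M $ \<omega> (n - 1)))"

lemma Ionescu_Tulcea_chain_kernel:
  fixes q :: "real ^ 'k::finite"
  shows "Ionescu_Tulcea (chain_kernel q M) (\<lambda>_. count_space UNIV)"
proof (rule Ionescu_Tulcea.intro)
  fix i
  show "chain_kernel q M i \<in> PiM {0..<i} (\<lambda>_. count_space UNIV) \<rightarrow>\<^sub>M subprob_algebra (count_space UNIV)"
  proof (cases i)
    case 0
    then show ?thesis
      by (simp add: chain_kernel_def[abs_def] measurable_const measure_pmf_in_subprob_algebra)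
  next
    case (Suc n)
    have "(\<lambda>\<omega>. \<omega> n) \<in> PiM {0..<i} (\<lambda>_. count_space UNIV) \<rightarrow>\<^sub>M count_space (UNIV :: 'k set)"
      by (rule measurable_component_singleton) (simp add: Suc)
    moreover have "(\<lambda>x. measure_pmf (vec_pmf (M $ x))) \<in>
        count_space UNIV \<rightarrow>\<^sub>M subprob_algebra (count_space UNIV)"
      by (simp add: measure_pmf_in_subprob_algebra)
    ultimately show ?thesis
      using measurable_compose by (fastforce simp: chain_kernel_def[abs_def] Suc)
  qed
next
  fix i :: nat and x :: "nat \<Rightarrow> 'k"
  show "prob_space (chain_kernel q M i x)"
    by (simp add: chain_kernel_def measure_pmf.prob_space_axioms)
qed

interpretation chain: Ionescu_Tulcea "chain_kernel q M" "\<lambda>_. count_space UNIV"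
  for q :: "real ^ 'k" and M :: "real ^ 'k ^ 'k::finite"
  by (rule Ionescu_Tulcea_chain_kernel)

definition chain_law :: "real ^ 'k \<Rightarrow> real ^ 'k ^ 'k::finite \<Rightarrow> (nat \<Rightarrow> 'k) measure" where
  "chain_law q M = chain.PF.lim q M"

lemma sets_chain_law [measurable_cong]: "sets (chain_law q M) = sets (PiM UNIV (\<lambda>_. count_space UNIV))"
  by (simp add: chain_law_def)

lemma space_chain_law [simp]: "space (chain_law q M) = UNIV"
  by (simp add: chain_law_def space_PiM)

lemma PiE_singletons: "PiE I (\<lambda>i. {x i}) = {restrict x I}"
proof -
  have "PiE I (\<lambda>i. {x i}) = PiE I (\<lambda>i. {restrict x I i})"
    by (rule PiE_cong) simp
  also have "\<dots> = {restrict x I}"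
    by (rule PiE_singleton) (rule restrict_extensional)
  finally show ?thesis .
qed

lemma emeasure_chain_C:
  fixes q :: "real ^ 'k::finite"
  assumes "q \<in> distributions" "stochastic_matrix M"
  shows "emeasure (chain.C q M 0 (Suc n) (\<lambda>_. undefined)) {restrict x {0..<Suc n}} =
    ennreal (q $ x 0 * (\<Prod>i<n. M $ x i $ x (Suc i)))"
proof -
  define D where "D n = PiM {0..<n} (\<lambda>_. count_space (UNIV :: 'k set))" for n :: nat
  define r where "r n = restrict x {0..<n}" for n
  have sp: "space (D n) = PiE {0..<n} (\<lambda>_. UNIV)" for n
    by (simp add: D_def space_PiM)
  have A: "{r n} \<in> sets (D n)" for n
  proof -
    have "PiE {0..<n} (\<lambda>i. {x i}) \<in> sets (D n)"
      unfolding D_def by (rule sets_PiM_I_finite) auto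
    also have "PiE {0..<n} (\<lambda>i. {x i}) = {r n}"
      unfolding r_def by (rule PiE_singletons)
    finally show ?thesis .
  qed
  have u: "(\<lambda>_. undefined) \<in> space (PiM {0..<0::nat} (\<lambda>_. count_space (UNIV :: 'k set)))"
    by (simp add: space_PiM)
  have step: "emeasure (chain.C q M 0 (Suc n) (\<lambda>_. undefined)) {r (Suc n)} =
      emeasure (chain.C q M 0 n (\<lambda>_. undefined)) {r n} * emeasure (chain_kernel q M n x) {x n}" for n
  proof -
    let ?C = "chain.C q M 0 n (\<lambda>_. undefined)"
    have setsC: "sets ?C = sets (D n)"
      using chain.sets_C[OF u] by (simp add: D_def)
    have spC: "space ?C = space (D n)"
      by (rule sets_eq_imp_space_eq[OF setsC])
    have ne: "space ?C \<noteq> {}"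
      unfolding spC sp by (auto simp: PiE_eq_empty_iff)
    have m: "chain.eP q M n \<in> ?C \<rightarrow>\<^sub>M subprob_algebra (D (Suc n))"
      using chain.measurable_eP[of q M n] unfolding measurable_cong_sets[OF setsC refl]
      by (simp add: D_def)
    have "emeasure (chain.C q M 0 (Suc n) (\<lambda>_. undefined)) {r (Suc n)} =
        (\<integral>\<^sup>+\<omega>. emeasure (chain.eP q M n \<omega>) {r (Suc n)} \<partial>?C)"
      using emeasure_bind[OF ne m A] by simp
    also have "\<dots> = (\<integral>\<^sup>+\<omega>. emeasure (chain_kernel q M n x) {x n} * indicator {r n} \<omega> \<partial>?C)"
    proof (rule nn_integral_cong)
      fix \<omega> assume "\<omega> \<in> space ?C"
      then have w: "\<omega> \<in> PiE {0..<n} (\<lambda>_. UNIV)"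
        by (simp add: spC sp)
      then have w': "\<omega> \<in> space (PiM {0..<n} (\<lambda>_. count_space UNIV))"
        by (simp add: space_PiM)
      have eq: "fun_upd \<omega> n y = r (Suc n) \<longleftrightarrow> \<omega> = r n \<and> y = x n" for y
        using w by (auto simp: r_def fun_eq_iff restrict_def PiE_def extensional_def less_Suc_eq)
      have "emeasure (chain.eP q M n \<omega>) {r (Suc n)} =
          emeasure (chain_kernel q M n \<omega>) {y. fun_upd \<omega> n y = r (Suc n)}"
        using chain.emeasure_eP[OF w' A[of "Suc n", unfolded D_def]]
        by (simp add: vimage_def)
      also have "\<dots> = emeasure (chain_kernel q M n x) {x n} * indicator {r n} \<omega>"
        unfolding eq by (auto simp: chain_kernel_def r_def indicator_def)
      finally show "emeasure (chain.eP q M n \<omega>) {r (Suc n)} =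
          emeasure (chain_kernel q M n x) {x n} * indicator {r n} \<omega>" .
    qed
    also have "\<dots> = emeasure (chain_kernel q M n x) {x n} * emeasure ?C {r n}"
      by (rule nn_integral_cmult_indicator) (simp add: setsC A)
    finally show ?thesis by (simp add: mult.commute)
  qed
  have nonneg: "0 \<le> q $ i" "0 \<le> M $ i $ j" and row: "M $ i \<in> distributions" for i j
    using assms by (auto simp: distributions_def stochastic_matrix_def)
  have kernel: "emeasure (chain_kernel q M 0 x) {x 0} = ennreal (q $ x 0)"
    "emeasure (chain_kernel q M (Suc m) x) {x (Suc m)} = ennreal (M $ x m $ x (Suc m))" for m
    using assms row by (simp_all add: chain_kernel_def emeasure_pmf_single pmf_vec_pmf)
  have "emeasure (chain.C q M 0 (Suc n) (\<lambda>_. undefined)) {r (Suc n)} =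
      ennreal (q $ x 0 * (\<Prod>i<n. M $ x i $ x (Suc i)))"
  proof (induction n)
    case 0
    have r0: "r 0 = (\<lambda>_. undefined)"
      by (simp add: r_def restrict_def)
    then have "emeasure (chain.C q M 0 0 (\<lambda>_. undefined)) {r 0} = 1"
      using A[of 0] by (simp add: D_def)
    then show ?case
      by (simp add: step[of 0] kernel del: chain.C.simps)
  next
    case (Suc n)
    show ?case
      unfolding step[of "Suc n"] Suc.IH kernel
      using nonneg by (simp add: ennreal_mult[symmetric] prod_nonneg mult.assoc)
  qed
  then show ?thesis by (simp add: r_def)
qed

lemma prob_space_chain_law: "prob_space (chain_law q M)"
proof (rule prob_spaceI)
  have "emeasure (chain.PF.lim q M) (chain.PF.emb UNIV {} (space (PiM {} (\<lambda>_. count_space UNIV)))) =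
      emeasure (chain.CI q M {}) (space (PiM {} (\<lambda>_. count_space UNIV)))"
    by (rule chain.lim) auto
  also have "\<dots> = 1"
    using prob_space.emeasure_space_1[OF chain.PF.prob_space_P[of "{}"]]
    by (simp add: chain.PF.space_P)
  finally show "emeasure (chain_law q M) (space (chain_law q M)) = 1"
    by (simp add: chain_law_def prod_emb_def space_PiM vimage_def restrict_def)
qed

text \<open>
  The finite-dimensional distributions, i.e. \<open>P(X\<^sub>1 = x\<^sub>0, \<dots>, X\<^bsub>n+1\<^esub> = x\<^sub>n)\<close>: under the law just
  defined, \<open>(X\<^sub>j)\<close> is the Markov chain with \<open>X\<^sub>1 \<sim> q\<close> and transition matrix \<open>M\<close>.
\<close>

lemma measure_chain_law_cylinder:
  fixes q :: "real ^ 'k::finite"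
  assumes "q \<in> distributions" "stochastic_matrix M"
  shows "measure (chain_law q M) {\<omega>. \<forall>i\<le>n. \<omega> i = x i} =
    q $ x 0 * (\<Prod>i<n. M $ x i $ x (Suc i))"
proof -
  let ?J = "{0..<Suc n}" and ?N = "\<lambda>_::nat. count_space (UNIV :: 'k set)"
  have eq: "{restrict x ?J} = PiE ?J (\<lambda>i. {x i})"
    by (rule PiE_singletons[symmetric])
  have A: "{restrict x ?J} \<in> sets (PiM ?J ?N)"
    unfolding eq by (rule sets_PiM_I_finite) auto
  have "{\<omega>. \<forall>i\<le>n. \<omega> i = x i} = chain.PF.emb UNIV ?J {restrict x ?J}"
    unfolding eq by (auto simp: prod_emb_def space_PiM PiE_iff less_Suc_eq_le)
  then have "emeasure (chain_law q M) {\<omega>. \<forall>i\<le>n. \<omega> i = x i} = emeasure (chain.CI q M ?J) {restrict x ?J}"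
    using chain.lim[of ?J "{restrict x ?J}" q M] A by (simp add: chain_law_def)
  also have "\<dots> = emeasure (chain.C q M 0 (Suc n) (\<lambda>_. undefined)) {restrict x ?J}"
    using chain.emeasure_CI[OF subset_refl A, of q M] A
    by (simp add: prod_emb_id[OF sets.sets_into_space[OF A, unfolded space_PiM]]
        del: chain.C.simps)
  also have "\<dots> = ennreal (q $ x 0 * (\<Prod>i<n. M $ x i $ x (Suc i)))"
    by (rule emeasure_chain_C[OF assms])
  finally show ?thesis
    using assms by (subst measure_eq_emeasure_eq_ennreal)
      (auto simp: distributions_def stochastic_matrix_def intro!: mult_nonneg_nonneg prod_nonneg)
qed

text \<open>
  A history after \<open>n\<close> stages is the list, in chronological order, of the pairs (action, signal) of
  stages \<open>1, \<dots>, n\<close>. A policy assigns an action to every history; the action at stage \<open>j\<close> is the one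
  assigned to the history of length \<open>j - 1\<close>, so the stage is determined by the history.
\<close>

type_synonym 'k policy = "('k \<times> bool) list \<Rightarrow> 'k"

fun history :: "'k policy \<Rightarrow> (nat \<Rightarrow> 'k) \<Rightarrow> nat \<Rightarrow> ('k \<times> bool) list" where
  "history \<xi> \<omega> 0 = []"
| "history \<xi> \<omega> (Suc n) =
    (let h = history \<xi> \<omega> n in h @ [(\<xi> h, \<omega> n = \<xi> h)])"

definition state :: "(nat \<Rightarrow> 'k) \<Rightarrow> nat \<Rightarrow> 'k" where
  "state \<omega> j = \<omega> (j - 1)"

definition action :: "'k policy \<Rightarrow> (nat \<Rightarrow> 'k) \<Rightarrow> nat \<Rightarrow> 'k" where
  "action \<xi> \<omega> j = \<xi> (history \<xi> \<omega> (j - 1))"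

definition expected_utility ::
    "('k \<Rightarrow> 'k \<Rightarrow> real) \<Rightarrow> real ^ 'k ^ 'k::finite \<Rightarrow> real ^ 'k \<Rightarrow> nat \<Rightarrow> 'k policy \<Rightarrow> real" where
  "expected_utility u M q n \<xi> = (\<integral>\<omega>. u (state \<omega> n) (action \<xi> \<omega> n) \<partial>chain_law q M)"

lemma measurable_coordinate: "(\<lambda>\<omega>. \<omega> n) \<in> chain_law q M \<rightarrow>\<^sub>M count_space UNIV"
  unfolding measurable_cong_sets[OF sets_chain_law refl]
  by (rule measurable_component_singleton) simp

lemma measurable_history: "(\<lambda>\<omega>. history \<xi> \<omega> n) \<in> chain_law q M \<rightarrow>\<^sub>M count_space UNIV"
proof (induction n)
  case (Suc n)
  let ?g = "\<lambda>h \<omega>. h @ [(\<xi> h, \<omega> n = \<xi> h)]"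
  have "(\<lambda>\<omega>. ?g (history \<xi> \<omega> n) \<omega>) \<in> chain_law q M \<rightarrow>\<^sub>M count_space UNIV"
  proof (rule measurable_compose_countable[OF _ Suc.IH])
    fix h
    show "?g h \<in> chain_law q M \<rightarrow>\<^sub>M count_space UNIV"
      by (rule measurable_compose[OF measurable_coordinate, of "\<lambda>x. h @ [(\<xi> h, x = \<xi> h)]"]) simp
  qed
  then show ?case by (simp add: Let_def)
qed simp

lemma integrable_utility:
  fixes u :: "'k::finite \<Rightarrow> 'k \<Rightarrow> real"
  shows "integrable (chain_law q M) (\<lambda>\<omega>. u (state \<omega> n) (action \<xi> \<omega> n))"
proof -
  interpret prob_space "chain_law q M"
    by (rule prob_space_chain_law)
  have m: "(\<lambda>\<omega>. u (state \<omega> n) (action \<xi> \<omega> n)) \<in> borel_measurable (chain_law q M)"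
    unfolding state_def action_def
  proof (rule measurable_compose_countable[OF _ measurable_history])
    fix h
    show "(\<lambda>\<omega>. u (\<omega> (n - 1)) (\<xi> h)) \<in> borel_measurable (chain_law q M)"
      by (rule measurable_compose[OF measurable_coordinate, of "\<lambda>x. u x (\<xi> h)"]) simp
  qed
  have "\<bar>u x a\<bar> \<le> Max (range (\<lambda>(x, a). \<bar>u x a\<bar>))" for x a
    by (rule Max_ge) (auto intro: rev_image_eqI[of "(x, a)"])
  then show ?thesis
    using m by (intro integrable_const_bound[where B = "Max (range (\<lambda>(x, a). \<bar>u x a\<bar>))"]) auto
qed

text \<open>
  \<open>n\<close> is the stage, \<open>n \<ge> 1\<close>. There are infinitely many policies, but they yield only finitely many
  expected utilities at stage \<open>n\<close> (lemma \<open>finite_range_expected_utility\<close> below), so \<open>Max\<close> is meaningful.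
\<close>

definition value_n ::
    "('k \<Rightarrow> 'k \<Rightarrow> real) \<Rightarrow> real ^ 'k ^ 'k::finite \<Rightarrow> real ^ 'k \<Rightarrow> nat \<Rightarrow> real" where
  "value_n u M q n = Max (range (expected_utility u M q n))"

lemma length_history [simp]: "length (history \<xi> \<omega> n) = n"
  by (induction n) (auto simp: Let_def)

lemma history_cong:
  assumes "\<And>h. length h < n \<Longrightarrow> \<xi> h = \<xi>' h"
  shows "history \<xi> \<omega> n = history \<xi>' \<omega> n"
  using assms by (induction n) (auto simp: Let_def)

lemma finite_range_expected_utility:
  fixes u :: "'k::finite \<Rightarrow> 'k \<Rightarrow> real"
  shows "finite (range (expected_utility u M q n))"
proof -
  let ?H = "{h :: ('k \<times> bool) list. length h \<le> n}"
  have eq: "expected_utility u M q n \<xi> = expected_utility u M q n (restrict \<xi> ?H)" for \<xi>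
  proof -
    have "action \<xi> \<omega> n = action (restrict \<xi> ?H) \<omega> n" for \<omega>
    proof -
      have "history (restrict \<xi> ?H) \<omega> (n - 1) = history \<xi> \<omega> (n - 1)"
        by (rule history_cong) auto
      then show ?thesis by (simp add: action_def)
    qed
    then show ?thesis
      by (simp add: expected_utility_def)
  qed
  have "range (expected_utility u M q n) \<subseteq> expected_utility u M q n ` (?H \<rightarrow>\<^sub>E UNIV)"
  proof (rule image_subsetI)
    fix \<xi> :: "'k policy"
    have "restrict \<xi> ?H \<in> ?H \<rightarrow>\<^sub>E UNIV"
      by (simp add: PiE_def)
    then show "expected_utility u M q n \<xi> \<in> expected_utility u M q n ` (?H \<rightarrow>\<^sub>E UNIV)"
      by (subst eq) (rule imageI)
  qed
  moreover have "finite (?H \<rightarrow>\<^sub>E (UNIV :: 'k set))"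
    using finite_lists_length_le[of "UNIV :: ('k \<times> bool) set" n] by (intro finite_PiE) auto
  ultimately show ?thesis
    using finite_surj by blast
qed

definition value_infinity ::
    "('k \<Rightarrow> 'k \<Rightarrow> real) \<Rightarrow> real ^ 'k ^ 'k::finite \<Rightarrow> real ^ 'k \<Rightarrow> real" where
  "value_infinity u M \<pi> = lim (value_n u M \<pi>)"

definition value_enat ::
    "('k \<Rightarrow> 'k \<Rightarrow> real) \<Rightarrow> real ^ 'k ^ 'k::finite \<Rightarrow> real ^ 'k \<Rightarrow> enat \<Rightarrow> real" where
  "value_enat u M \<pi> n = (case n of enat m \<Rightarrow> value_n u M \<pi> m | \<infinity> \<Rightarrow> value_infinity u M \<pi>)"

definition predictive_learning_index ::
    "('k \<Rightarrow> 'k \<Rightarrow> real) \<Rightarrow> real ^ 'k ^ 'k::finite \<Rightarrow> real ^ 'k \<Rightarrow> enat" where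
  "predictive_learning_index u M \<pi> =
    (LEAST n. 1 \<le> n \<and> value_enat u M \<pi> n = value_infinity u M \<pi>)"

end

theory Submission
  imports Defs
begin

text \<open>
  Stage-\<open>n\<close> expected utilities are linear in the prior. If \<open>\<xi>\<close> is optimal at stage \<open>n\<close> for \<open>\<pi>\<close> and
  the value does not increase at stage \<open>n + 1\<close>, then probing a state \<open>a\<close> of the support of \<open>\<pi>\<close>
  first, and deviating from \<open>\<xi>\<close> only upon a hit, cannot help: so \<open>\<xi>\<close> is optimal for every row
  \<open>M $ a\<close> of the support at once. This simultaneous optimality passes on to stage \<open>n + 1\<close> by
  ignoring the first signal, since the support of \<open>\<pi>\<close> is closed under transitions, and it makes
  the first signal worthless.
\<close>

section \<open>Integrals of functions of finitely many coordinates of the chain\<close>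

lemma integral_chain_law_finite_dim:
  fixes q :: "real ^ 'k::finite" and f :: "(nat \<Rightarrow> 'k) \<Rightarrow> real"
  assumes q: "q \<in> distributions" and M: "stochastic_matrix M"
    and f: "\<And>\<omega> \<omega>'. (\<And>i. i \<le> n \<Longrightarrow> \<omega> i = \<omega>' i) \<Longrightarrow> f \<omega> = f \<omega>'"
  shows "(\<integral>\<omega>. f \<omega> \<partial>chain_law q M) =
    (\<Sum>xs | length xs = Suc n. f ((!) xs) * (q $ (xs ! 0) * (\<Prod>i<n. M $ (xs ! i) $ (xs ! Suc i))))"
proof -
  let ?L = "{xs :: 'k list. length xs = Suc n}"
  let ?A = "\<lambda>xs. {\<omega>. \<forall>i\<le>n. \<omega> i = xs ! i}"
  interpret prob_space "chain_law q M"
    by (rule prob_space_chain_law)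
  have fin: "finite ?L"
    using finite_lists_length_eq[of "UNIV :: 'k set" "Suc n"] by simp
  have A: "?A xs \<in> sets (chain_law q M)" for xs
  proof -
    have "?A xs = (\<Inter>i\<in>{..n}. (\<lambda>\<omega>. \<omega> i) -` {xs ! i} \<inter> space (chain_law q M))"
      by auto
    also have "\<dots> \<in> sets (chain_law q M)"
      by (intro sets.finite_INT measurable_sets[OF measurable_coordinate]) auto
    finally show ?thesis .
  qed
  \<comment> \<open>Exactly one list contributes, the prefix of \<open>\<omega>\<close>. The path
    \<open>(!) xs\<close> carries no information beyond index \<open>n\<close>, but \<open>f\<close>
    does not look there.\<close>
  have "f \<omega> = (\<Sum>xs\<in>?L. f ((!) xs) * indicator (?A xs) \<omega>)" for \<omega>
  proof -
    let ?ys = "map \<omega> [0..<Suc n]"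
    have nth: "?ys ! i = \<omega> i" if "i \<le> n" for i
      using that by (simp del: upt_Suc)
    have eq: "\<omega> \<in> ?A xs \<longleftrightarrow> xs = ?ys" if "length xs = Suc n" for xs
    proof
      assume "\<omega> \<in> ?A xs"
      then show "xs = ?ys"
        using that by (intro nth_equalityI) (auto simp: less_Suc_eq_le simp del: upt_Suc)
    qed (use nth in \<open>auto simp del: upt_Suc\<close>)
    have "(\<Sum>xs\<in>?L. f ((!) xs) * indicator (?A xs) \<omega>) = (\<Sum>xs\<in>?L. if xs = ?ys then f ((!) xs) else 0)"
      by (rule sum.cong[OF refl]) (use eq in \<open>auto simp: indicator_def simp del: upt_Suc\<close>)
    also have "\<dots> = f ((!) ?ys)"
      by (subst sum.delta[OF fin]) (simp del: upt_Suc)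
    also have "\<dots> = f \<omega>"
      by (rule f) (rule nth)
    finally show ?thesis by simp
  qed
  then have "(\<integral>\<omega>. f \<omega> \<partial>chain_law q M) =
      (\<integral>\<omega>. (\<Sum>xs\<in>?L. f ((!) xs) * indicator (?A xs) \<omega>) \<partial>chain_law q M)"
    by (intro Bochner_Integration.integral_cong refl)
  also have "\<dots> = (\<Sum>xs\<in>?L. f ((!) xs) * measure (chain_law q M) (?A xs))"
    using A by (subst Bochner_Integration.integral_sum) (auto simp: emeasure_eq_measure)
  finally show ?thesis
    by (simp add: measure_chain_law_cylinder[OF q M])
qed

lemma lists_length_Suc_bij_betw:
  "bij_betw (\<lambda>(x, xs). x # xs) (UNIV \<times> {xs. length xs = n}) {xs :: 'a list. length xs = Suc n}"
  by (auto simp: bij_betw_def inj_on_def length_Suc_conv image_iff)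

text \<open>Once the factor \<open>q $ i\<close> of the first state is split off, the remaining path
  weight is that of a chain with initial law \<open>M $ i\<close>.\<close>

lemma integral_chain_law_first_step:
  fixes q :: "real ^ 'k::finite" and f :: "(nat \<Rightarrow> 'k) \<Rightarrow> real"
  assumes q: "q \<in> distributions" and M: "stochastic_matrix M"
    and f: "\<And>\<omega> \<omega>'. (\<And>i. i \<le> Suc n \<Longrightarrow> \<omega> i = \<omega>' i) \<Longrightarrow> f \<omega> = f \<omega>'"
  shows "(\<integral>\<omega>. f \<omega> \<partial>chain_law q M) =
    (\<Sum>i\<in>UNIV. q $ i * (\<integral>\<omega>. f (case_nat i \<omega>) \<partial>chain_law (M $ i) M))"
proof -
  have row: "M $ i \<in> distributions" for i
    using M by (simp add: stochastic_matrix_def)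
  have f': "f (case_nat i \<omega>) = f (case_nat i \<omega>')" if "\<And>j. j \<le> n \<Longrightarrow> \<omega> j = \<omega>' j" for i \<omega> \<omega>'
    by (rule f) (use that in \<open>auto split: nat.split\<close>)
  have rows: "(\<integral>\<omega>. f (case_nat i \<omega>) \<partial>chain_law (M $ i) M) =
      (\<Sum>xs | length xs = Suc n. f (case_nat i ((!) xs)) *
        (M $ i $ (xs ! 0) * (\<Prod>j<n. M $ (xs ! j) $ (xs ! Suc j))))" for i
    by (rule integral_chain_law_finite_dim[OF row M f'])
  have nth: "(!) (x # xs) = case_nat x ((!) xs)" for x :: 'k and xs
    by (rule ext) (simp add: nth_Cons)
  let ?w = "\<lambda>xs. f ((!) xs) * (q $ (xs ! 0) * (\<Prod>j<Suc n. M $ (xs ! j) $ (xs ! Suc j)))"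
  have "(\<integral>\<omega>. f \<omega> \<partial>chain_law q M) = (\<Sum>xs | length xs = Suc (Suc n). ?w xs)"
    by (rule integral_chain_law_finite_dim[OF q M f])
  also have "\<dots> = (\<Sum>(i, xs)\<in>UNIV \<times> {xs. length xs = Suc n}. ?w (i # xs))"
    using sum.reindex_bij_betw[OF lists_length_Suc_bij_betw, of ?w "Suc n", symmetric]
    by (simp only: case_prod_unfold)
  also have "\<dots> = (\<Sum>i\<in>UNIV. \<Sum>xs | length xs = Suc n. q $ i * (f (case_nat i ((!) xs)) *
      (M $ i $ (xs ! 0) * (\<Prod>j<n. M $ (xs ! j) $ (xs ! Suc j)))))"
    unfolding sum.cartesian_product[symmetric] nth prod.lessThan_Suc_shift
    by (simp add: mult_ac)
  also have "\<dots> = (\<Sum>i\<in>UNIV. q $ i * (\<integral>\<omega>. f (case_nat i \<omega>) \<partial>chain_law (M $ i) M))"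
    by (simp only: rows sum_distrib_left)
  finally show ?thesis .
qed

section \<open>First-step recursion for histories and expected utilities\<close>

definition continuation :: "'k policy \<Rightarrow> 'k \<Rightarrow> 'k policy" where
  "continuation \<xi> x = (\<lambda>h. \<xi> ((\<xi> [], x = \<xi> []) # h))"

text \<open>Histories grow at the end, whereas conditioning on the first state needs the first stage
  split off at the front.\<close>

lemma history_Suc_first:
  "history \<xi> \<omega> (Suc n) =
    (\<xi> [], \<omega> 0 = \<xi> []) # history (continuation \<xi> (\<omega> 0)) (\<lambda>i. \<omega> (Suc i)) n"
proof (induction n)
  case (Suc n)
  show ?case
    unfolding history.simps(2)[of \<xi> \<omega> "Suc n"] Suc.IH
    by (simp add: Let_def continuation_def)
qed simp

lemma history_cong_path:
  assumes "\<And>i. i < n \<Longrightarrow> \<omega> i = \<omega>' i"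
  shows "history \<xi> \<omega> n = history \<xi> \<omega>' n"
  using assms by (induction n) (auto simp: Let_def)

text \<open>The index is the number of elapsed stages: \<open>gain u M n \<xi> i\<close> is the stage-\<open>(n + 1)\<close> expected
  utility of the chain started in state \<open>i\<close>.\<close>

fun gain :: "('k \<Rightarrow> 'k \<Rightarrow> real) \<Rightarrow> real ^ 'k ^ 'k::finite \<Rightarrow> nat \<Rightarrow> 'k policy \<Rightarrow> 'k \<Rightarrow> real" where
  "gain u M 0 \<xi> i = u i (\<xi> [])"
| "gain u M (Suc n) \<xi> i = (\<Sum>j\<in>UNIV. M $ i $ j * gain u M n (continuation \<xi> i) j)"

text \<open>As \<open>gain\<close> does not involve the prior, this makes expected utilities linear
  in it.\<close>

lemma expected_utility_eq_gain:
  assumes "q \<in> distributions" "stochastic_matrix M"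
  shows "expected_utility u M q (Suc n) \<xi> = (\<Sum>i\<in>UNIV. q $ i * gain u M n \<xi> i)"
  using assms(1)
proof (induction n arbitrary: q \<xi>)
  case 0
  let ?f = "\<lambda>\<omega> :: nat \<Rightarrow> 'a. u (\<omega> 0) (\<xi> [])"
  interpret prob_space "chain_law q' M" for q'
    by (rule prob_space_chain_law)
  have "(\<integral>\<omega>. ?f \<omega> \<partial>chain_law q M) =
      (\<Sum>i\<in>UNIV. q $ i * (\<integral>\<omega>. ?f (case_nat i \<omega>) \<partial>chain_law (M $ i) M))"
    by (rule integral_chain_law_first_step[OF 0 assms(2), where n = 0]) simp
  then show ?case
    using prob_space by (simp add: expected_utility_def state_def action_def)
next
  case (Suc n)
  have row: "M $ i \<in> distributions" for i
    using assms(2) by (simp add: stochastic_matrix_def)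
  let ?f = "\<lambda>\<omega>. u (\<omega> (Suc n)) (\<xi> (history \<xi> \<omega> (Suc n)))"
  have "?f \<omega> = ?f \<omega>'" if "\<And>i. i \<le> Suc n \<Longrightarrow> \<omega> i = \<omega>' i" for \<omega> \<omega>'
    using history_cong_path[of "Suc n" \<omega> \<omega>' \<xi>] that by simp
  then have "(\<integral>\<omega>. ?f \<omega> \<partial>chain_law q M) =
      (\<Sum>i\<in>UNIV. q $ i * (\<integral>\<omega>. ?f (case_nat i \<omega>) \<partial>chain_law (M $ i) M))"
    by (rule integral_chain_law_first_step[OF Suc.prems assms(2), where n = n])
  also have "\<dots> = (\<Sum>i\<in>UNIV. q $ i * expected_utility u M (M $ i) (Suc n) (continuation \<xi> i))"
    unfolding history_Suc_first
    by (simp add: expected_utility_def state_def action_def continuation_def)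
  also have "\<dots> = (\<Sum>i\<in>UNIV. q $ i * gain u M (Suc n) \<xi> i)"
    by (simp add: Suc.IH[OF row])
  finally show ?case
    by (simp add: expected_utility_def state_def action_def)
qed

text \<open>After the first stage the problem restarts with prior \<open>M $ i\<close>; the
  continuation varies with \<open>i\<close> only through the first signal.\<close>

lemma expected_utility_Suc_Suc:
  assumes "q \<in> distributions" "stochastic_matrix M"
  shows "expected_utility u M q (Suc (Suc n)) \<xi> =
    (\<Sum>i\<in>UNIV. q $ i * expected_utility u M (M $ i) (Suc n) (continuation \<xi> i))"
proof -
  have "M $ i \<in> distributions" for i
    using assms(2) by (simp add: stochastic_matrix_def)
  then show ?thesis
    using assms by (simp add: expected_utility_eq_gain)
qed

text \<open>The prior \<open>q v* M\<close> is a mixture of the rows. For invariant \<open>q\<close>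
  this gives a sum over rows with one common policy, comparable term by term with
  \<open>expected_utility_Suc_Suc\<close>.\<close>

lemma expected_utility_vector_matrix_mult:
  assumes "q v* M \<in> distributions" "stochastic_matrix M"
  shows "expected_utility u M (q v* M) (Suc n) \<xi> =
    (\<Sum>i\<in>UNIV. q $ i * expected_utility u M (M $ i) (Suc n) \<xi>)"
proof -
  have row: "M $ i \<in> distributions" for i
    using assms(2) by (simp add: stochastic_matrix_def)
  have "expected_utility u M (q v* M) (Suc n) \<xi> =
      (\<Sum>j\<in>UNIV. \<Sum>i\<in>UNIV. q $ i * (M $ i $ j * gain u M n \<xi> j))"
    using assms by (simp add: expected_utility_eq_gain vector_matrix_mult_def sum_distrib_right mult.assoc)
  also have "\<dots> = (\<Sum>i\<in>UNIV. q $ i * (\<Sum>j\<in>UNIV. M $ i $ j * gain u M n \<xi> j))"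
    by (subst sum.swap) (simp add: sum_distrib_left)
  finally show ?thesis
    using assms row by (simp add: expected_utility_eq_gain)
qed

lemma expected_utility_le_value_n: "expected_utility u M q n \<xi> \<le> value_n u M q n"
  unfolding value_n_def by (rule Max_ge[OF finite_range_expected_utility]) simp

lemma value_n_attained:
  obtains \<xi> where "value_n u M q n = expected_utility u M q n \<xi>"
proof -
  have "value_n u M q n \<in> range (expected_utility u M q n)"
    unfolding value_n_def by (rule Max_in[OF finite_range_expected_utility]) simp
  then show thesis using that by auto
qed

section \<open>Policies that drop or exploit the first signal\<close>

definition delay :: "'k policy \<Rightarrow> 'k policy" where
  "delay \<xi> = (\<lambda>h. \<xi> (tl h))"

lemma continuation_delay [simp]: "continuation (delay \<xi>) x = \<xi>"
  by (simp add: continuation_def delay_def)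

definition probe :: "'k \<Rightarrow> 'k policy \<Rightarrow> 'k policy \<Rightarrow> 'k policy" where
  "probe a \<eta> \<xi> = (\<lambda>h. if h = [] then a else if snd (hd h) then \<eta> (tl h) else \<xi> (tl h))"

text \<open>A hit reveals that the state is exactly \<open>a\<close>, so the deviation to
  \<open>\<eta>\<close> affects a single row.\<close>

lemma continuation_probe: "continuation (probe a \<eta> \<xi>) x = (if x = a then \<eta> else \<xi>)"
  by (auto simp: continuation_def probe_def)

section \<open>Invariant priors and simultaneous optimality on the support\<close>

context
  fixes M :: "real ^ 'k ^ 'k::finite" and \<pi> :: "real ^ 'k" and u :: "'k \<Rightarrow> 'k \<Rightarrow> real"
  assumes M: "stochastic_matrix M" and \<pi>: "invariant_distribution M \<pi>"
begin

lemma row_distributions: "M $ i \<in> distributions"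
  using M by (simp add: stochastic_matrix_def)

lemma invariant_in_distributions: "\<pi> \<in> distributions"
  using \<pi> by (simp add: invariant_distribution_def)

text \<open>By invariance, the mass \<open>\<pi> $ a * M $ a $ i\<close> flowing from
  \<open>a\<close> to \<open>i\<close> is part of \<open>\<pi> $ i\<close>.\<close>

lemma support_closed:
  assumes "\<pi> $ a \<noteq> 0" "M $ a $ i \<noteq> 0"
  shows "\<pi> $ i \<noteq> 0"
proof -
  have nonneg: "0 \<le> \<pi> $ j" "0 \<le> M $ j $ k" for j k
    using invariant_in_distributions row_distributions by (auto simp: distributions_def)
  have "0 < \<pi> $ a * M $ a $ i"
    using assms nonneg by (simp add: less_le)
  also have "\<dots> \<le> (\<Sum>j\<in>UNIV. \<pi> $ j * M $ j $ i)"
    by (rule member_le_sum) (simp_all add: nonneg)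
  also have "\<dots> = (\<pi> v* M) $ i"
    by (simp add: vector_matrix_mult_def)
  also have "\<dots> = \<pi> $ i"
    using \<pi> by (simp add: invariant_distribution_def)
  finally show ?thesis by simp
qed

lemma expected_utility_invariant:
  "expected_utility u M \<pi> (Suc n) \<xi> = (\<Sum>i\<in>UNIV. \<pi> $ i * expected_utility u M (M $ i) (Suc n) \<xi>)"
  using expected_utility_vector_matrix_mult[of \<pi> M u n \<xi>] \<pi> M
  by (simp add: invariant_distribution_def)

lemma value_n_le_Suc: "value_n u M \<pi> n \<le> value_n u M \<pi> (Suc n)"
proof (cases n)
  \<comment> \<open>Stage \<open>0\<close> coincides with stage \<open>1\<close>, because
    \<open>0 - 1 = 0\<close> on naturals.\<close>
  case 0
  then show ?thesis
    by (simp add: value_n_def expected_utility_def[abs_def] state_def action_def)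
next
  case (Suc m)
  obtain \<xi> where "value_n u M \<pi> (Suc m) = expected_utility u M \<pi> (Suc m) \<xi>"
    by (rule value_n_attained)
  also have "\<dots> = expected_utility u M \<pi> (Suc (Suc m)) (delay \<xi>)"
    by (simp add: expected_utility_Suc_Suc[OF invariant_in_distributions M]
        expected_utility_invariant[of _ \<xi>])
  also have "\<dots> \<le> value_n u M \<pi> (Suc (Suc m))"
    by (rule expected_utility_le_value_n)
  finally show ?thesis using Suc by simp
qed

text \<open>A single policy serves all rows of the support, so learning the initial state
  \<open>a\<close> before the transition would bring no gain.\<close>

definition optimal_on_support :: "nat \<Rightarrow> 'k policy \<Rightarrow> bool" where
  "optimal_on_support n \<xi> \<longleftrightarrow> (\<forall>a \<eta>. \<pi> $ a \<noteq> 0 \<longrightarrow>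
    expected_utility u M (M $ a) n \<eta> \<le> expected_utility u M (M $ a) n \<xi>)"

lemma optimal_on_support_if_value_n_eq:
  assumes "value_n u M \<pi> (Suc (Suc n)) = value_n u M \<pi> (Suc n)"
  obtains \<xi> where "optimal_on_support (Suc n) \<xi>"
proof -
  obtain \<xi> where \<xi>: "value_n u M \<pi> (Suc n) = expected_utility u M \<pi> (Suc n) \<xi>"
    by (rule value_n_attained)
  let ?E = "\<lambda>i. expected_utility u M (M $ i) (Suc n)"
  have "?E a \<eta> \<le> ?E a \<xi>" if a: "\<pi> $ a \<noteq> 0" for a \<eta>
  proof -
    have "(\<Sum>i\<in>UNIV. \<pi> $ i * ?E i (if i = a then \<eta> else \<xi>)) =
        expected_utility u M \<pi> (Suc (Suc n)) (probe a \<eta> \<xi>)"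
      using invariant_in_distributions M
      by (simp add: expected_utility_Suc_Suc continuation_probe)
    also have "\<dots> \<le> (\<Sum>i\<in>UNIV. \<pi> $ i * ?E i \<xi>)"
      using expected_utility_le_value_n[of u M \<pi> "Suc (Suc n)"] assms \<xi>
      by (simp add: expected_utility_invariant)
    \<comment> \<open>The two sums differ only in the term at \<open>a\<close>; the others
      cancel.\<close>
    finally have "\<pi> $ a * ?E a \<eta> \<le> \<pi> $ a * ?E a \<xi>"
      by (simp add: sum.remove[of UNIV a])
    moreover have "0 < \<pi> $ a"
      using a invariant_in_distributions by (simp add: distributions_def less_le)
    ultimately show ?thesis by simp
  qed
  then have "optimal_on_support (Suc n) \<xi>"
    by (simp add: optimal_on_support_def)
  then show thesis by (rule that)
qed

text \<open>Only rows \<open>M $ i\<close> with \<open>i\<close> in the support of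
  \<open>\<pi>\<close> carry weight, and there \<open>\<xi>\<close> beats every continuation of
  \<open>\<eta>\<close>. A general \<open>q\<close> covers both \<open>\<pi>\<close> and the rows of
  its support.\<close>

lemma expected_utility_Suc_le_if_optimal_on_support:
  assumes opt: "optimal_on_support (Suc n) \<xi>"
    and q: "q \<in> distributions" "\<And>i. q $ i \<noteq> 0 \<Longrightarrow> \<pi> $ i \<noteq> 0"
  shows "expected_utility u M q (Suc (Suc n)) \<eta> \<le> expected_utility u M q (Suc (Suc n)) (delay \<xi>)"
proof -
  have "q $ i * expected_utility u M (M $ i) (Suc n) (continuation \<eta> i) \<le>
      q $ i * expected_utility u M (M $ i) (Suc n) \<xi>" for i
    using opt q by (cases "q $ i = 0")
      (auto simp: optimal_on_support_def distributions_def intro!: mult_left_mono)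
  then show ?thesis
    by (simp add: expected_utility_Suc_Suc[OF q(1) M] sum_mono)
qed

lemma optimal_on_support_delay:
  assumes "optimal_on_support (Suc n) \<xi>"
  shows "optimal_on_support (Suc (Suc n)) (delay \<xi>)"
  unfolding optimal_on_support_def
  using expected_utility_Suc_le_if_optimal_on_support[OF assms row_distributions] support_closed
  by blast

text \<open>The policy \<open>delay \<xi>\<close> is optimal for \<open>\<pi>\<close> one stage
  later, and by invariance it earns there what \<open>\<xi>\<close> earns now.\<close>

lemma value_n_Suc_eq_if_optimal_on_support:
  assumes "optimal_on_support (Suc n) \<xi>"
  shows "value_n u M \<pi> (Suc (Suc n)) = value_n u M \<pi> (Suc n)"
proof (rule antisym[OF _ value_n_le_Suc])
  obtain \<eta> where "value_n u M \<pi> (Suc (Suc n)) = expected_utility u M \<pi> (Suc (Suc n)) \<eta>"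
    by (rule value_n_attained)
  also have "\<dots> \<le> expected_utility u M \<pi> (Suc (Suc n)) (delay \<xi>)"
    by (rule expected_utility_Suc_le_if_optimal_on_support[OF assms invariant_in_distributions])
  also have "\<dots> = expected_utility u M \<pi> (Suc n) \<xi>"
    by (simp add: expected_utility_Suc_Suc[OF invariant_in_distributions M]
        expected_utility_invariant[of _ \<xi>])
  also have "\<dots> \<le> value_n u M \<pi> (Suc n)"
    by (rule expected_utility_le_value_n)
  finally show "value_n u M \<pi> (Suc (Suc n)) \<le> value_n u M \<pi> (Suc n)" .
qed

lemma value_n_add_eq:
  assumes "value_n u M \<pi> (Suc (Suc n)) = value_n u M \<pi> (Suc n)"
  shows "value_n u M \<pi> (Suc (n + j)) = value_n u M \<pi> (Suc n)"
proof -
  obtain \<xi> where \<xi>: "optimal_on_support (Suc n) \<xi>"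
    using optimal_on_support_if_value_n_eq[OF assms] .
  \<comment> \<open>The induction carries the existence of a simultaneously optimal policy; the
    equality of successive values is read off from it at each stage.\<close>
  have "\<exists>\<eta>. optimal_on_support (Suc (n + j)) \<eta>" for j
    by (induction j) (auto intro: \<xi> dest: optimal_on_support_delay)
  then have "value_n u M \<pi> (Suc (Suc (n + j))) = value_n u M \<pi> (Suc (n + j))" for j
    using value_n_Suc_eq_if_optimal_on_support by blast
  then show ?thesis
    by (induction j) simp_all
qed

end

section \<open>The limit value and the learning index\<close>

lemma value_n_le_1:
  assumes "\<And>x a. u x a \<in> {0..1}"
  shows "value_n u M q n \<le> 1"
proof -
  interpret prob_space "chain_law q M"
    by (rule prob_space_chain_law)
  obtain \<xi> where "value_n u M q n = expected_utility u M q n \<xi>"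
    by (rule value_n_attained)
  also have "\<dots> \<le> 1"
    unfolding expected_utility_def
    using assms by (intro integral_le_const integrable_utility) auto
  finally show ?thesis .
qed

text \<open>Monotonicity and the bound \<open>1\<close> turn the \<open>lim\<close> in
  \<open>value_infinity\<close> into a genuine limit.\<close>

lemma value_n_tendsto_value_infinity:
  assumes "stochastic_matrix M" "\<And>x a. u x a \<in> {0..1}" "invariant_distribution M \<pi>"
  shows "value_n u M \<pi> \<longlonglongrightarrow> value_infinity u M \<pi>"
proof -
  have "incseq (value_n u M \<pi>)"
    using value_n_le_Suc[OF assms(1,3)] by (rule incseq_SucI)
  then have "convergent (value_n u M \<pi>)"
    using value_n_le_1[of u, OF assms(2)]
    by (auto simp: convergent_def elim: incseq_convergent[where B = 1])
  then show ?thesis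
    by (simp add: value_infinity_def convergent_LIMSEQ_iff)
qed

text \<open>Forward, the next value is squeezed between the present one and the limit; backward, the
  sequence is constant from stage \<open>Suc n\<close> on.\<close>

lemma value_n_eq_value_infinity_iff:
  assumes "stochastic_matrix M" "\<And>x a. u x a \<in> {0..1}" "invariant_distribution M \<pi>"
  shows "value_n u M \<pi> (Suc n) = value_infinity u M \<pi> \<longleftrightarrow>
    value_n u M \<pi> (Suc (Suc n)) = value_n u M \<pi> (Suc n)"
proof
  have "incseq (value_n u M \<pi>)"
    using value_n_le_Suc[OF assms(1,3)] by (rule incseq_SucI)
  then have "value_n u M \<pi> (Suc (Suc n)) \<le> value_infinity u M \<pi>"
    using value_n_tendsto_value_infinity[of M u, OF assms] by (rule incseq_le)
  then show "value_n u M \<pi> (Suc (Suc n)) = value_n u M \<pi> (Suc n)"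
    if "value_n u M \<pi> (Suc n) = value_infinity u M \<pi>"
    using that value_n_le_Suc[OF assms(1,3), where u = u and n = "Suc n"] by simp
next
  assume "value_n u M \<pi> (Suc (Suc n)) = value_n u M \<pi> (Suc n)"
  then have "value_n u M \<pi> (j + Suc n) = value_n u M \<pi> (Suc n)" for j
    using value_n_add_eq[OF assms(1,3), of u n j] by (simp add: add.commute)
  then have "(\<lambda>_. value_n u M \<pi> (Suc n)) \<longlonglongrightarrow> value_infinity u M \<pi>"
    using LIMSEQ_ignore_initial_segment[OF value_n_tendsto_value_infinity[of M u, OF assms], of "Suc n"]
    by simp
  then show "value_n u M \<pi> (Suc n) = value_infinity u M \<pi>"
    by (simp add: LIMSEQ_const_iff)
qed

theorem theorem2:
  fixes M :: "real ^ 'k ^ 'k::finite"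
    and \<pi> :: "real ^ 'k"
    and u :: "'k \<Rightarrow> 'k \<Rightarrow> real"
  assumes "stochastic_matrix M"
    and "\<And>x a. u x a \<in> {0..1}"
    and "invariant_distribution M \<pi>"
  shows "(\<forall>n\<ge>1. value_n u M \<pi> (n + 1) = value_n u M \<pi> n \<longrightarrow>
            (\<forall>j\<ge>1. value_n u M \<pi> (n + 1 + j) = value_n u M \<pi> n)) \<and>
         predictive_learning_index u M \<pi> =
           (LEAST n. 1 \<le> n \<and> value_enat u M \<pi> (n + 1) = value_enat u M \<pi> n)"
proof (intro conjI allI impI)
  fix n j :: nat
  assume n: "1 \<le> n" and eq: "value_n u M \<pi> (n + 1) = value_n u M \<pi> n"
  then obtain m where m: "n = Suc m"
    by (cases n) auto
  show "value_n u M \<pi> (n + 1 + j) = value_n u M \<pi> n"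
    using value_n_add_eq[OF assms(1,3), of u m "Suc j"] eq by (simp add: m)
next
  \<comment> \<open>The two conditions agree at every index, so the two sets coincide and not merely
    their minima.\<close>
  have "value_enat u M \<pi> n = value_infinity u M \<pi> \<longleftrightarrow> value_enat u M \<pi> (n + 1) = value_enat u M \<pi> n"
    if n: "1 \<le> n" for n
  proof (cases n)
    case (enat k)
    then obtain m where m: "n = enat (Suc m)"
      using n by (cases k) (auto simp: one_enat_def)
    show ?thesis
      using value_n_eq_value_infinity_iff[of M u, OF assms, of m]
      by (simp add: m value_enat_def one_enat_def)
  \<comment> \<open>At \<open>\<infinity>\<close> both equations hold, since
    \<open>\<infinity> + 1 = \<infinity>\<close>.\<close>
  qed (simp add: value_enat_def)
  then show "predictive_learning_index u M \<pi> =
      (LEAST n. 1 \<le> n \<and> value_enat u M \<pi> (n + 1) = value_enat u M \<pi> n)"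
    unfolding predictive_learning_index_def by (intro arg_cong[where f = Least]) auto
qed

end
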